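(* Let $n \geq 1$ be an integer. Every tree character on $[n]$ is admissible. That is, if $\mathcal{C}$ is a tree character on $[n]$, then there is a preference order $\succeq$ on $\mathcal{P}([n])$ whose collection of separable sets is exactly $\mathcal{C}$, i.e. $\mathrm{char}(\succeq) = \mathcal{C}$.
   Context: $[n]=\{1,\dots,n\}$, and $\mathcal{P}([n])$ is its power set. Subsets $A\subseteq[n]$ are identified with bitstrings (outcomes) $x\in\mathbb{Z}_2^n$ via $x_i=1$ iff $i\in A$. A preference order $\succeq$ is a total preorder (reflexive, transitive, any two elements comparable; ties allowed) on $\mathcal{P}([n])$, equivalently on $\mathbb{Z}_2^n$. Write $x\sim y$ when $x\succeq y$ and $y\succeq x$. For $S\subseteq[n]$, write $-S=[n]\setminus S$. A partial outcome on $S$ is a bitstring indexed by $S$; for partial outcomes $x_S$ on $S$ and $u_{-S}$ on $-S$, $x_Su_{-S}$ denotes the outcome on $[n]$ that restricts to $x_S$ on $S$ and to $u_{-S}$ on $-S$; $0_{-S}$ is the all-zero partial outcome on $-S$. The set $S$ is separable with respect to $\succeq$ when for all partial outcomes $x_S,y_S$ on $S$ and all partial outcomes $v_{-S}$ on $-S$: $x_S0_{-S}\succeq y_S0_{-S} \iff x_Sv_{-S}\succeq y_Sv_{-S}$. The character of $\succeq$ is $\mathrm{char}(\succeq)=\{S\subseteq[n] : S \text{ is separable with respect to }\succeq\}$. A tree character on $[n]$ is a collection $\mathcal{C}\subseteq\mathcal{P}([n])$ with $\emptyset\in\mathcal{C}$ and $[n]\in\mathcal{C}$ such that the Hasse diagram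 of $\mathcal{C}\setminus\{\emptyset\}$ (ordered by inclusion) is a tree rooted at $[n]$; in other words, for all $A,B\in\mathcal{C}$ one of the following is true: $A=B$, $A\subsetneq B$, $A\supsetneq B$, or $A\cap B=\emptyset$. *)

theory Defs
  imports Main
begin

(* Outcomes on [n] are the subsets of {1..n}: a bitstring x is identified with {i. x_i = 1}.
   A pair (x, y) in the relation R is read "x is weakly preferred to y".
   total_on compares distinct elements only; equal ones are covered by reflexivity. *)

definition preference_order :: "nat \<Rightarrow> nat set rel \<Rightarrow> bool" where
  "preference_order n R \<longleftrightarrow> preorder_on (Pow {1..n}) R \<and> total_on (Pow {1..n}) R"

(* Under the same identification, a partial outcome on S is a subset of S, the all-zero one is the
   empty set, and for x on S and u on -S the combined outcome x_S u_{-S} is the union of x and u. *)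

definition partial_outcomes :: "nat set \<Rightarrow> nat set set" where
  "partial_outcomes S = Pow S"

definition combine :: "nat set \<Rightarrow> nat set \<Rightarrow> nat set" where
  "combine x u = x \<union> u"

definition zero_outcome :: "nat set" where
  "zero_outcome = {}"

definition separable :: "nat \<Rightarrow> nat set rel \<Rightarrow> nat set \<Rightarrow> bool" where
  "separable n R S \<longleftrightarrow>
     (\<forall>x\<in>partial_outcomes S. \<forall>y\<in>partial_outcomes S. \<forall>v\<in>partial_outcomes ({1..n} - S).
        (combine x zero_outcome, combine y zero_outcome) \<in> R \<longleftrightarrow> (combine x v, combine y v) \<in> R)"

definition character :: "nat \<Rightarrow> nat set rel \<Rightarrow> nat set set" where
  "character n R = {S. S \<subseteq> {1..n} \<and> separable n R S}"

definition tree_character :: "nat \<Rightarrow> nat set set \<Rightarrow> bool" where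
  "tree_character n C \<longleftrightarrow>
     C \<subseteq> Pow {1..n} \<and> {} \<in> C \<and> {1..n} \<in> C \<and>
     (\<forall>A\<in>C. \<forall>B\<in>C. A = B \<or> A \<subset> B \<or> B \<subset> A \<or> A \<inter> B = {})"

definition admissible :: "nat \<Rightarrow> nat set set \<Rightarrow> bool" where
  "admissible n C \<longleftrightarrow> (\<exists>R. preference_order n R \<and> character n R = C)"

end

(* Preferences are induced by a utility function, built by recursion on the tree. At a node A with
   children K the utility of x is the sum of the utilities of its parts in the children, plus a bonus
   for A itself and, if some two children do not cover A, a bonus when x avoids the elements of A
   outside all children ("loose" ones) and misses part of at most one child. For a fixed loose part
   the bonus only depends on which children are contained in x and is monotone in that, so the
   children, and with them the sets separable inside a child, are separable in A.
   A separable S outside C would meet A in one of three ways. If S contains a loose element s, adding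
   s to S - {s} is never an improvement until S is completed to A. If S meets two children and cuts
   one of them, B, properly, completing B makes S Int B jump from utility <= 1 to 3, past what
   S contains of the other child B': a set of utility 1 if B' is contained in S, and otherwise
   S Int B', which overtakes S Int B in the same way when B' is completed.
   If S is a union of children, the bonuses, which depend on the child that is missed, reverse the
   comparison of S without B and S without B' for two of these children. *)
theory Submission
  imports Defs Complex_Main
begin

section \<open>Separability and normalized utilities\<close>

text \<open>Utilities replace relations so that the values of children can be added. A larger value
  means preferred, and the empty context stands for the zero outcome.\<close>

definition sep_on :: "('a set \<Rightarrow> real) \<Rightarrow> 'a set \<Rightarrow> 'a set \<Rightarrow> bool" where
  "sep_on u A S \<longleftrightarrow>
     (\<forall>x y v. x \<subseteq> S \<longrightarrow> y \<subseteq> S \<longrightarrow> v \<subseteq> A - S \<longrightarrow> (u x \<le> u y \<longleftrightarrow> u (x \<union> v) \<le> u (y \<union> v)))"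

text \<open>The top value 3 exceeds 1 + 1, the most that two incomplete children contribute
  together. The top value 1 occurs only if no nonempty proper subset of \<open>A\<close> lies in
  \<open>C\<close>. The set \<open>q\<close> of value exactly 1 serves as a rival to an incomplete
  child.\<close>

definition normalized :: "'a set set \<Rightarrow> 'a set \<Rightarrow> ('a set \<Rightarrow> real) \<Rightarrow> bool" where
  "normalized C A u \<longleftrightarrow>
     u {} = 0 \<and> (\<forall>x. x \<subseteq> A \<longrightarrow> 0 \<le> u x) \<and> (\<forall>x. x \<subset> A \<longrightarrow> u x \<le> 1 \<and> u x < u A) \<and>
     (u A = 1 \<or> u A = 3) \<and> (\<exists>q. q \<subseteq> A \<and> u q = 1) \<and>
     (\<forall>D\<in>C. D \<subseteq> A \<longrightarrow> D \<noteq> {} \<longrightarrow> 0 < u D \<and> (D \<noteq> A \<longrightarrow> u A = 3))"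

definition represents :: "'a set set \<Rightarrow> 'a set \<Rightarrow> ('a set \<Rightarrow> real) \<Rightarrow> bool" where
  "represents C A u \<longleftrightarrow> (\<forall>S. S \<subseteq> A \<longrightarrow> (sep_on u A S \<longleftrightarrow> S \<in> C))"

lemma sep_on_iff:
  assumes "sep_on u A S" "x \<subseteq> S" "y \<subseteq> S" "v \<subseteq> A - S"
  shows "u x \<le> u y \<longleftrightarrow> u (x \<union> v) \<le> u (y \<union> v)"
  using assms(1)[unfolded sep_on_def, rule_format, OF assms(2-4)] .

text \<open>Any two contexts agree because each agrees with the empty one. A set is thus refuted by
  two contexts with opposite verdicts.\<close>

lemma sep_on_shift:
  assumes "sep_on u A S" "x \<subseteq> S" "y \<subseteq> S" "v \<subseteq> A - S" "w \<subseteq> A - S"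
  shows "u (x \<union> v) \<le> u (y \<union> v) \<longleftrightarrow> u (x \<union> w) \<le> u (y \<union> w)"
  using sep_on_iff[OF assms(1-4)] sep_on_iff[OF assms(1-3,5)] by simp

section \<open>Utility at one node of the tree\<close>

text \<open>\<open>K\<close> holds the children of \<open>A\<close>; \<open>norm\<close> and
  \<open>rep\<close> are the induction hypothesis for them. By \<open>beta\<close> the bonuses are
  ordered like the utilities of the full children, with gaps of 3, while those utilities differ by
  at most 2.\<close>

locale node =
  fixes A :: "'a set" and C K :: "'a set set" and u :: "'a set \<Rightarrow> 'a set \<Rightarrow> real"
    and \<beta> :: "'a set \<Rightarrow> real"
  assumes fin: "finite A" and ne: "A \<noteq> {}" and AC: "A \<in> C" and eC: "{} \<in> C"
    and disj: "\<And>B B'. B \<in> K \<Longrightarrow> B' \<in> K \<Longrightarrow> B \<noteq> B' \<Longrightarrow> B \<inter> B' = {}"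
    and Kne: "\<And>B. B \<in> K \<Longrightarrow> B \<noteq> {}" and Ksub: "\<And>B. B \<in> K \<Longrightarrow> B \<subset> A"
    and cover: "\<And>D. D \<in> C \<Longrightarrow> D \<subset> A \<Longrightarrow> D \<noteq> {} \<Longrightarrow> \<exists>B\<in>K. D \<subseteq> B"
    and norm: "\<And>B. B \<in> K \<Longrightarrow> normalized C B (u B)"
    and rep: "\<And>B. B \<in> K \<Longrightarrow> represents C B (u B)"
    and beta0: "\<And>B. B \<in> K \<Longrightarrow> 0 \<le> \<beta> B"
    and beta: "\<And>B B'. B \<in> K \<Longrightarrow> B' \<in> K \<Longrightarrow> B \<noteq> B' \<Longrightarrow>
       \<beta> B + 3 \<le> \<beta> B' \<and> u B B \<le> u B' B' \<or> \<beta> B' + 3 \<le> \<beta> B \<and> u B' B' \<le> u B B"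
begin

definition "loose = A - \<Union>K"
definition "missed x = {B \<in> K. \<not> B \<subseteq> x}"
text \<open>Fails exactly when there is at most one child or two children partition
  \<open>A\<close>. Then no proper subset of \<open>A\<close> contains two children. In the second
  case a bonus for missing one child would break the additivity in \<open>util_two\<close>.\<close>

definition "corrected \<longleftrightarrow> (\<exists>B\<in>K. \<exists>B'\<in>K. B \<noteq> B' \<and> B \<union> B' \<noteq> A)"
text \<open>The value \<open>sum \<beta> K\<close> for missing no child bounds every single
  \<open>\<beta> B\<close>, so completing a child never lowers the bonus. The extra 1 makes
  \<open>A\<close> the strict maximum.\<close>

definition "bonus x =
  (if x = A then sum \<beta> K + 1
   else if \<not> corrected \<or> x \<inter> loose \<noteq> {} then 0
   else if missed x = {} then sum \<beta> K
   else if \<exists>B. missed x = {B} then \<beta> (the_elem (missed x))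
   else 0)"
definition "util x = (\<Sum>B\<in>K. u B (x \<inter> B)) + bonus x"

lemma finite_K: "finite K"
  using Ksub fin by (metis finite_Pow_iff finite_subset PowI psubset_imp_subset subsetI)

lemma u_empty: "B \<in> K \<Longrightarrow> u B {} = 0"
  using norm unfolding normalized_def by blast

lemma u_nonneg: "B \<in> K \<Longrightarrow> x \<subseteq> B \<Longrightarrow> 0 \<le> u B x"
  using norm unfolding normalized_def by blast

lemma u_proper: "B \<in> K \<Longrightarrow> x \<subset> B \<Longrightarrow> u B x \<le> 1 \<and> u B x < u B B"
  using norm unfolding normalized_def by blast

lemma u_le_full: "B \<in> K \<Longrightarrow> x \<subseteq> B \<Longrightarrow> u B x \<le> u B B"
  using u_proper by (cases "x = B") (auto intro: less_imp_le)

lemma u_full: "B \<in> K \<Longrightarrow> u B B = 1 \<or> u B B = 3"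
  using norm unfolding normalized_def by blast

lemma u_pos: "B \<in> K \<Longrightarrow> D \<in> C \<Longrightarrow> D \<subseteq> B \<Longrightarrow> D \<noteq> {} \<Longrightarrow> 0 < u B D"
  using norm unfolding normalized_def by blast

lemma u_full_rich: "B \<in> K \<Longrightarrow> D \<in> C \<Longrightarrow> D \<subset> B \<Longrightarrow> D \<noteq> {} \<Longrightarrow> u B B = 3"
  using norm unfolding normalized_def by blast

lemma beta_le_sum: "B \<in> K \<Longrightarrow> \<beta> B \<le> sum \<beta> K"
  using member_le_sum[of B K \<beta>] finite_K beta0 by blast

lemma sum_beta_nonneg: "0 \<le> sum \<beta> K"
  using beta0 by (simp add: sum_nonneg)

lemma bonus_A: "bonus A = sum \<beta> K + 1"
  by (simp add: bonus_def)

lemma bonus_bounds: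
  assumes "x \<noteq> A"
  shows "0 \<le> bonus x \<and> bonus x \<le> sum \<beta> K"
proof (cases "\<exists>B. missed x = {B}")
  case True
  then obtain B where B: "missed x = {B}" by blast
  then have "B \<in> K" unfolding missed_def by blast
  then show ?thesis
    using B assms beta0 beta_le_sum sum_beta_nonneg by (simp add: bonus_def)
next
  case False
  then show ?thesis using assms sum_beta_nonneg by (simp add: bonus_def)
qed

lemma bonus_nonneg: "0 \<le> bonus x"
  using bonus_bounds[of x] bonus_A sum_beta_nonneg by (cases "x = A") simp_all

lemma bonus_less: "x \<noteq> A \<Longrightarrow> bonus x < bonus A"
  using bonus_bounds[of x] bonus_A by simp

lemma bonus_zero:
  assumes "B \<in> missed x" "corrected \<Longrightarrow> x \<inter> loose = {} \<Longrightarrow> \<exists>B'\<in>missed x. B' \<noteq> B"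
  shows "bonus x = 0"
proof -
  have "x \<noteq> A" using assms(1) Ksub unfolding missed_def by blast
  show ?thesis
  proof (cases "corrected \<and> x \<inter> loose = {}")
    case True
    then obtain B' where "B' \<in> missed x" "B' \<noteq> B" using assms(2) by blast
    then have "missed x \<noteq> {}" "\<nexists>B. missed x = {B}" using assms(1) by blast+
    then show ?thesis using \<open>x \<noteq> A\<close> by (simp add: bonus_def)
  next
    case False
    then show ?thesis using \<open>x \<noteq> A\<close> by (auto simp: bonus_def)
  qed
qed

lemma bonus_one:
  assumes "corrected" "x \<inter> loose = {}" "missed x = {B}"
  shows "bonus x = \<beta> B"
proof -
  have "x \<noteq> A" using assms(3) Ksub unfolding missed_def by blast
  then show ?thesis using assms by (simp add: bonus_def)
qed

section \<open>Comparisons that vary within one child\<close>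

lemma util_split:
  assumes "B \<in> K"
  shows "util x = u B (x \<inter> B) + (\<Sum>B'\<in>K - {B}. u B' (x \<inter> B')) + bonus x"
  unfolding util_def using sum.remove[OF finite_K assms, of "\<lambda>B. u B (x \<inter> B)"] by simp

text \<open>A change inside \<open>B\<close> that leaves \<open>B\<close> incomplete affects neither
  the loose part nor the set of missed children.\<close>

lemma bonus_child_partial:
  assumes "B \<in> K" "p - B = q - B" "\<not> B \<subseteq> p" "\<not> B \<subseteq> q"
  shows "bonus p = bonus q"
proof -
  have "p \<inter> loose = q \<inter> loose" using assms unfolding loose_def by blast
  moreover have "B' \<subseteq> p \<longleftrightarrow> B' \<subseteq> q" if "B' \<in> K" for B'
    using assms disj[OF assms(1) that] by (cases "B' = B") blast+
  then have "missed p = missed q" unfolding missed_def by blast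
  moreover have "p \<noteq> A" "q \<noteq> A" using assms Ksub by blast+
  ultimately show ?thesis unfolding bonus_def by simp
qed

text \<open>Before its completion \<open>B\<close> is missed, so the bonus is 0 unless
  \<open>B\<close> is the only missed child; in that case it rises from \<open>\<beta> B\<close> to
  at least \<open>sum \<beta> K\<close>.\<close>

lemma bonus_child_full:
  assumes "B \<in> K" "p - B = q - B" "\<not> B \<subseteq> p" "B \<subseteq> q"
  shows "bonus p \<le> bonus q"
proof (cases "q = A")
  case True
  then show ?thesis using bonus_less[of p] by (cases "p = A") auto
next
  case False
  have pA: "p \<noteq> A" using assms Ksub by blast
  have l: "p \<inter> loose = q \<inter> loose" using assms unfolding loose_def by blast
  have "B' \<subseteq> p \<longleftrightarrow> B' \<subseteq> q" if "B' \<in> K" "B' \<noteq> B" for B'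
    using assms disj[OF assms(1) that(1)] that(2) by blast
  then have m: "missed q = missed p - {B}" "B \<in> missed p"
    unfolding missed_def using assms by blast+
  consider "\<not> corrected \<or> p \<inter> loose \<noteq> {}" | "corrected" "p \<inter> loose = {}" "missed p = {B}"
    | "\<nexists>B. missed p = {B}" using m(2) by blast
  then show ?thesis
  proof cases
    case 1
    then have "bonus p = 0" using pA by (auto simp: bonus_def)
    then show ?thesis using bonus_nonneg by simp
  next
    case 2
    then have "bonus q = sum \<beta> K" using m l False by (simp add: bonus_def)
    then show ?thesis using bonus_one[OF 2] beta_le_sum[OF assms(1)] by simp
  next
    case 3
    then have "bonus p = 0" using pA m(2) by (auto simp: bonus_def)
    then show ?thesis using bonus_nonneg by simp
  qed
qed

lemma util_child_less:
  assumes "B \<in> K" "p - B = q - B" "\<not> B \<subseteq> p" "B \<subseteq> q"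
  shows "util p < util q" "u B (p \<inter> B) < u B (q \<inter> B)"
proof -
  have "p \<inter> B' = q \<inter> B'" if "B' \<in> K - {B}" for B'
    using assms disj[OF assms(1), of B'] that by blast
  then have "(\<Sum>B'\<in>K - {B}. u B' (p \<inter> B')) = (\<Sum>B'\<in>K - {B}. u B' (q \<inter> B'))" by simp
  moreover have *: "q \<inter> B = B" "p \<inter> B \<subset> B" using assms by blast+
  then show "u B (p \<inter> B) < u B (q \<inter> B)" using u_proper[OF assms(1)] by simp
  ultimately show "util p < util q"
    using bonus_child_full[OF assms] util_split[OF assms(1)] by simp
qed

text \<open>While \<open>B\<close> stays incomplete the bonus is constant; completing
  \<open>B\<close> raises \<open>u B\<close> strictly and does not lower the bonus. This carries
  separability from \<open>B\<close> to \<open>A\<close> and back.\<close>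

lemma util_child:
  assumes "B \<in> K" "p - B = q - B"
  shows "util p \<le> util q \<longleftrightarrow> u B (p \<inter> B) \<le> u B (q \<inter> B)"
proof -
  consider "B \<subseteq> p" "B \<subseteq> q" | "\<not> B \<subseteq> p" "B \<subseteq> q" | "B \<subseteq> p" "\<not> B \<subseteq> q" | "\<not> B \<subseteq> p" "\<not> B \<subseteq> q" by blast
  then show ?thesis
  proof cases
    case 1
    then have "p = q" using assms(2) by blast
    then show ?thesis by simp
  next
    case 2
    then show ?thesis using util_child_less[OF assms] by simp
  next
    case 3
    then show ?thesis using util_child_less[OF assms(1) assms(2)[symmetric]] by simp
  next
    case 4
    have "p \<inter> B' = q \<inter> B'" if "B' \<in> K - {B}" for B'
      using assms disj[OF assms(1), of B'] that by blast
    then have "(\<Sum>B'\<in>K - {B}. u B' (p \<inter> B')) = (\<Sum>B'\<in>K - {B}. u B' (q \<inter> B'))" by simp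
    then show ?thesis using bonus_child_partial[OF assms 4] util_split[OF assms(1)] by simp
  qed
qed

lemma sep_on_child:
  assumes "B \<in> K" "S \<subseteq> B" and s: "sep_on (u B) B S"
  shows "sep_on util A S"
  unfolding sep_on_def
proof (intro allI impI)
  fix x y v assume h: "x \<subseteq> S" "y \<subseteq> S" "v \<subseteq> A - S"
  have "v \<inter> B \<subseteq> B - S" using h by blast
  then have "u B x \<le> u B y \<longleftrightarrow> u B (x \<union> v \<inter> B) \<le> u B (y \<union> v \<inter> B)"
    using h by (intro sep_on_iff[OF s])
  moreover have "x \<inter> B = x" "y \<inter> B = y" "(x \<union> v) \<inter> B = x \<union> v \<inter> B" "(y \<union> v) \<inter> B = y \<union> v \<inter> B"
    "x - B = y - B" "(x \<union> v) - B = (y \<union> v) - B" using h assms by blast+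
  ultimately show "util x \<le> util y \<longleftrightarrow> util (x \<union> v) \<le> util (y \<union> v)"
    using util_child[OF assms(1), of x y] util_child[OF assms(1), of "x \<union> v" "y \<union> v"] by simp
qed

text \<open>By \<open>util_child\<close>, comparisons and contexts inside \<open>B\<close> can be
  read off from \<open>u B\<close>, whose separable sets are those in \<open>C\<close>.\<close>

lemma sep_on_Int_child:
  assumes "sep_on util A S" "S \<subseteq> A" "B \<in> K"
  shows "S \<inter> B \<in> C"
proof -
  have "sep_on (u B) B (S \<inter> B)" unfolding sep_on_def
  proof (intro allI impI)
    fix x y v assume h: "x \<subseteq> S \<inter> B" "y \<subseteq> S \<inter> B" "v \<subseteq> B - S \<inter> B"
    then have "v \<subseteq> A - S" using Ksub[OF assms(3)] by blast
    then have "util x \<le> util y \<longleftrightarrow> util (x \<union> v) \<le> util (y \<union> v)"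
      using h by (intro sep_on_iff[OF assms(1)]) blast+
    moreover have "x \<inter> B = x" "y \<inter> B = y" "(x \<union> v) \<inter> B = x \<union> v" "(y \<union> v) \<inter> B = y \<union> v"
      "x - B = y - B" "(x \<union> v) - B = (y \<union> v) - B" using h assms by blast+
    ultimately show "u B x \<le> u B y \<longleftrightarrow> u B (x \<union> v) \<le> u B (y \<union> v)"
      using util_child[OF assms(3), of x y] util_child[OF assms(3), of "x \<union> v" "y \<union> v"] by simp
  qed
  then show ?thesis using rep[OF assms(3)] unfolding represents_def by blast
qed

section \<open>Excluding separable sets outside \<open>C\<close>\<close>

text \<open>Since \<open>s\<close> lies in no child, \<open>S\<close> and \<open>S - {s}\<close>
  differ only in the bonus. It is 0 for \<open>S\<close> alone, but in the context
  \<open>A - S\<close> the set \<open>S\<close> becomes \<open>A\<close> and wins strictly.\<close>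

lemma sep_on_loose:
  assumes "sep_on util A S" "S \<subset> A" "s \<in> S" "s \<in> loose"
  shows False
proof -
  have sums: "(\<Sum>B\<in>K. u B (x \<inter> B)) = (\<Sum>B\<in>K. u B ((x - {s}) \<inter> B))" for x
  proof (rule sum.cong)
    fix B assume "B \<in> K"
    then have "x \<inter> B = (x - {s}) \<inter> B" using assms(4) unfolding loose_def by blast
    then show "u B (x \<inter> B) = u B ((x - {s}) \<inter> B)" by simp
  qed simp
  have "bonus S = 0" using assms by (auto simp: bonus_def)
  then have "util S \<le> util (S - {s})"
    using sums[of S] bonus_nonneg[of "S - {s}"] by (simp add: util_def)
  then have "util (S \<union> (A - S)) \<le> util ((S - {s}) \<union> (A - S))"
    using sep_on_iff[OF assms(1), of S "S - {s}" "A - S"] by blast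
  moreover have "S \<union> (A - S) = A" "(S - {s}) \<union> (A - S) = A - {s}" using assms by blast+
  moreover have "A - {s} \<noteq> A" using assms by blast
  ultimately show False
    using bonus_less[of "A - {s}"] sums[of A] by (simp add: util_def)
qed

text \<open>The bonus vanishes: a nonempty \<open>loose\<close> cancels it, and if
  \<open>loose\<close> is empty, \<open>corrected\<close> forces a third child, which is missed
  along with \<open>B\<close> or \<open>B'\<close>.\<close>

lemma util_two:
  assumes "B \<in> K" "B' \<in> K" "B \<noteq> B'" "D \<subseteq> B" "D' \<subseteq> B'" "D \<noteq> B \<or> D' \<noteq> B'"
  shows "util (D \<union> D' \<union> loose) = u B D + u B' D'"
proof -
  let ?z = "D \<union> D' \<union> loose"
  have d: "B \<inter> B' = {}" using disj assms by blast
  have l: "loose \<inter> B'' = {}" if "B'' \<in> K" for B'' using that unfolding loose_def by blast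
  have z: "?z \<inter> B = D" "?z \<inter> B' = D'" using l assms d by blast+
  have z': "?z \<inter> B'' = {}" if "B'' \<in> K - {B, B'}" for B''
    using l[of B''] disj[of B B''] disj[of B' B''] assms that by blast
  have "bonus ?z = 0"
  proof -
    have "B \<in> missed ?z \<or> B' \<in> missed ?z" using assms z unfolding missed_def by blast
    then obtain B0 where B0: "B0 \<in> missed ?z" "B0 \<in> {B, B'}" by blast
    have "\<exists>B''\<in>missed ?z. B'' \<noteq> B0" if c: "corrected" and "?z \<inter> loose = {}"
    proof -
      have "loose = {}" using that by blast
      then have U: "\<Union>K = A" using Ksub unfolding loose_def by blast
      have "K \<noteq> {B, B'}"
      proof
        assume K2: "K = {B, B'}"
        then have "B \<union> B' = A" using U by simp
        then show False using c K2 unfolding corrected_def by blast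
      qed
      then obtain B'' where B'': "B'' \<in> K - {B, B'}" using assms(1,2) by blast
      then have "B'' \<noteq> {}" "?z \<inter> B'' = {}" using Kne z' by blast+
      then have "B'' \<in> missed ?z" using B'' unfolding missed_def by blast
      then show ?thesis using B'' B0(2) by blast
    qed
    then show ?thesis using bonus_zero[OF B0(1)] by blast
  qed
  moreover have "(\<Sum>B''\<in>K. u B'' (?z \<inter> B'')) = (\<Sum>B''\<in>{B, B'}. u B'' (?z \<inter> B''))"
    using assms z' u_empty by (intro sum.mono_neutral_right finite_K) auto
  ultimately show ?thesis using z assms(3) unfolding util_def by simp
qed

lemma partial_beats:
  assumes "sep_on util A S" "S \<subseteq> A - loose" "B \<in> K" "B' \<in> K" "B \<noteq> B'"
    and "S \<inter> B \<noteq> {}" "S \<inter> B \<noteq> B" "q \<subseteq> S \<inter> B'" "u B' q \<le> 1" "v \<subseteq> A - S"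
  shows "util (q \<union> v) < util (S \<inter> B \<union> v)"
proof -
  have d: "B \<inter> B' = {}" using disj assms by blast
  \<comment> \<open>A nonempty proper subset of \<open>B\<close> in \<open>C\<close> forces the top
    value 3.\<close>
  have "S \<inter> B \<in> C" using sep_on_Int_child assms by blast
  then have full: "u B B = 3" using u_full_rich[OF assms(3)] assms by blast
  \<comment> \<open>In this context \<open>S \<inter> B\<close> is completed to \<open>B\<close> and
    scores 3, while \<open>q\<close> reaches at most 1 + 1.\<close>
  let ?w = "(B - S) \<union> loose"
  have w: "?w \<subseteq> A - S" using assms(2,3) Ksub unfolding loose_def by blast
  have "util ((B - S) \<union> q \<union> loose) = u B (B - S) + u B' q"
    using assms by (intro util_two) blast+
  moreover have "u B (B - S) \<le> 1" using u_proper[OF assms(3)] assms by blast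
  moreover have "util (B \<union> {} \<union> loose) = u B B + u B' {}"
    using assms Kne[OF assms(4)] by (intro util_two) blast+
  ultimately have "util ((B - S) \<union> q \<union> loose) < util (B \<union> {} \<union> loose)"
    using full assms(9) u_empty[OF assms(4)] by simp
  moreover have "(B - S) \<union> q \<union> loose = q \<union> ?w" "B \<union> {} \<union> loose = S \<inter> B \<union> ?w" by blast+
  ultimately have "\<not> util (S \<inter> B \<union> ?w) \<le> util (q \<union> ?w)" by simp
  moreover have "q \<subseteq> S" "S \<inter> B \<subseteq> S" using assms by blast+
  ultimately have "\<not> util (S \<inter> B \<union> v) \<le> util (q \<union> v)"
    using sep_on_shift[OF assms(1) _ _ w assms(10)] by blast
  then show ?thesis by simp
qed

lemma sep_on_partial:
  assumes "sep_on util A S" "S \<subseteq> A - loose" "B \<in> K" "B' \<in> K" "B \<noteq> B'"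
    and "S \<inter> B \<noteq> {}" "S \<inter> B \<noteq> B" "S \<inter> B' \<noteq> {}"
  shows False
proof (cases "S \<inter> B' = B'")
  case True
  \<comment> \<open>The value of \<open>q\<close> is the largest that the incomplete
    \<open>S \<inter> B\<close> can have, so \<open>S \<inter> B\<close> cannot beat
    \<open>q\<close> strictly.\<close>
  obtain q where q: "q \<subseteq> B'" "u B' q = 1" using norm[OF assms(4)] unfolding normalized_def by blast
  have v: "loose \<subseteq> A - S" using assms(2) unfolding loose_def by blast
  have "util (q \<union> loose) < util (S \<inter> B \<union> loose)"
    using q True assms v by (intro partial_beats[where B' = B']) auto
  moreover have "util (S \<inter> B \<union> {} \<union> loose) = u B (S \<inter> B) + u B' {}"
    using assms by (intro util_two) blast+
  moreover have "util ({} \<union> q \<union> loose) = u B {} + u B' q"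
    using assms q Kne by (intro util_two) blast+
  moreover have "u B (S \<inter> B) \<le> 1" using u_proper[OF assms(3)] assms by blast
  ultimately show False using u_empty assms q by simp
next
  case False
  have le1: "u B (S \<inter> B) \<le> 1" "u B' (S \<inter> B') \<le> 1"
    using u_proper[OF assms(3), of "S \<inter> B"] u_proper[OF assms(4), of "S \<inter> B'"] assms False by blast+
  \<comment> \<open>Both children are cut, so each part beats the other in the empty
    context.\<close>
  have "util (S \<inter> B' \<union> {}) < util (S \<inter> B \<union> {})"
    using assms le1 by (intro partial_beats[where B' = B']) auto
  moreover have "util (S \<inter> B \<union> {}) < util (S \<inter> B' \<union> {})"
    using assms le1 False by (intro partial_beats[where B' = B]) auto
  ultimately show False by simp
qed

lemma util_remove_child:
  assumes "B \<in> K" "B \<subseteq> z"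
  shows "util (z - B) = (\<Sum>B'\<in>K. u B' (z \<inter> B')) - u B B + bonus (z - B)"
proof -
  have "(\<Sum>B'\<in>K - {B}. u B' ((z - B) \<inter> B')) = (\<Sum>B'\<in>K - {B}. u B' (z \<inter> B'))"
  proof (rule sum.cong)
    fix B' assume "B' \<in> K - {B}"
    then have "(z - B) \<inter> B' = z \<inter> B'" using disj[OF assms(1), of B'] by blast
    then show "u B' ((z - B) \<inter> B') = u B' (z \<inter> B')" by simp
  qed simp
  moreover have "(z - B) \<inter> B = {}" "z \<inter> B = B" using assms by blast+
  ultimately show ?thesis
    using util_split[OF assms(1), of "z - B"] u_empty[OF assms(1)]
      sum.remove[OF finite_K assms(1), of "\<lambda>B. u B (z \<inter> B)"] by simp
qed

text \<open>Two contexts decide between dropping \<open>B\<close> and dropping \<open>B'\<close>.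
  With \<open>loose\<close> there is no bonus, and dropping the more valuable \<open>B'\<close>
  costs at least as much. With \<open>\<Union>K - S\<close> only the dropped child is missed, and
  its bonus decides.\<close>

lemma sep_on_union_aux:
  assumes "sep_on util A S" "S \<subset> A" "S \<subseteq> \<Union>K"
    and all: "\<And>B. B \<in> K \<Longrightarrow> S \<inter> B = {} \<or> B \<subseteq> S"
    and B: "B \<in> K" "B' \<in> K" "B \<noteq> B'" "B \<subseteq> S" "B' \<subseteq> S"
    and b: "\<beta> B + 3 \<le> \<beta> B'" "u B B \<le> u B' B'"
  shows False
proof -
  have "B \<union> B' \<noteq> A" using B(4,5) assms(2) by blast
  then have cor: corrected using B(1-3) unfolding corrected_def by blast
  let ?v = "\<Union>K - S"
  have UA: "\<Union>K \<subseteq> A" using Ksub by blast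
  then have v: "?v \<subseteq> A - S" "loose \<subseteq> A - S" using assms(3) unfolding loose_def by blast+
  \<comment> \<open>A nonempty \<open>loose\<close> cancels the bonus; otherwise the children cover
    \<open>A\<close> and one of them, different from \<open>E\<close>, is not contained in
    \<open>S\<close>.\<close>
  have nb: "bonus ((S \<union> loose) - E) = 0" if E: "E \<in> K" "E \<subseteq> S" for E
  proof (rule bonus_zero[where B = E])
    show "E \<in> missed ((S \<union> loose) - E)" using E Kne[OF E(1)] unfolding missed_def by blast
    assume "((S \<union> loose) - E) \<inter> loose = {}"
    then have "loose = {}" using E unfolding loose_def by blast
    then have "\<Union>K = A" using UA unfolding loose_def by blast
    then obtain B3 where "B3 \<in> K" "\<not> B3 \<subseteq> S" using assms(2) by blast
    then have "B3 \<in> missed ((S \<union> loose) - E)" "B3 \<noteq> E"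
      using \<open>loose = {}\<close> E(2) unfolding missed_def by blast+
    then show "\<exists>B'\<in>missed ((S \<union> loose) - E). B' \<noteq> E" by blast
  qed
  have b1: "bonus (\<Union>K - E) = \<beta> E" if E: "E \<in> K" for E
  proof (rule bonus_one[OF cor])
    show "(\<Union>K - E) \<inter> loose = {}" unfolding loose_def by blast
    have "B' \<subseteq> \<Union>K - E \<longleftrightarrow> B' \<noteq> E" if "B' \<in> K" for B'
      using that disj[OF E that] Kne[OF that] by (cases "B' = E") auto
    then show "missed (\<Union>K - E) = {E}" using E unfolding missed_def by blast
  qed
  have sub: "B \<subseteq> S \<union> loose" "B' \<subseteq> S \<union> loose" "B \<subseteq> \<Union>K" "B' \<subseteq> \<Union>K" using B by blast+
  have "util ((S \<union> loose) - B') \<le> util ((S \<union> loose) - B)"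
    using util_remove_child[OF B(1) sub(1)] util_remove_child[OF B(2) sub(2)] nb B b by simp
  moreover have eq: "(S \<union> loose) - E = (S - E) \<union> loose" "\<Union>K - E = (S - E) \<union> ?v"
    if "E \<in> K" "E \<subseteq> S" for E
    using that assms(3) unfolding loose_def by blast+
  moreover have "util ((S - B') \<union> loose) \<le> util ((S - B) \<union> loose) \<longleftrightarrow>
      util ((S - B') \<union> ?v) \<le> util ((S - B) \<union> ?v)"
    by (rule sep_on_shift[OF assms(1) _ _ v(2,1)]) blast+
  ultimately have "util (\<Union>K - B') \<le> util (\<Union>K - B)"
    using eq[OF B(1,4)] eq[OF B(2,5)] by simp
  then have "\<beta> B' - u B' B' \<le> \<beta> B - u B B"
    using util_remove_child[OF B(1) sub(3)] util_remove_child[OF B(2) sub(4)] b1 B by simp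
  \<comment> \<open>Full children have utility 1 or 3, a difference of at most 2, which is less than
    the gap 3 of the bonuses.\<close>
  then show False using b u_full[OF B(1)] u_full[OF B(2)] by auto
qed

lemma sep_on_in_C:
  assumes "sep_on util A S" "S \<subseteq> A"
  shows "S \<in> C"
proof (rule ccontr)
  assume nC: "S \<notin> C"
  have SA: "S \<subset> A" using nC AC assms by blast
  have nl: "S \<inter> loose = {}" using sep_on_loose[OF assms(1) SA] by blast
  then have SU: "S \<subseteq> \<Union>K" "S \<subseteq> A - loose" using assms(2) unfolding loose_def by blast+
  have "S \<noteq> {}" using nC eC by blast
  then obtain B where B: "B \<in> K" "S \<inter> B \<noteq> {}" using SU by blast
  \<comment> \<open>A set inside one child is its own trace there and would lie in \<open>C\<close>;
    hence \<open>S\<close> meets a second child.\<close>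
  have "\<not> S \<subseteq> B" using sep_on_Int_child[OF assms B(1)] nC by (metis inf.orderE)
  then obtain B' where B': "B' \<in> K" "S \<inter> B' \<noteq> {}" "B \<noteq> B'" using SU by blast
  have other: "\<exists>E'\<in>K. S \<inter> E' \<noteq> {} \<and> E' \<noteq> E" for E using B B' by blast
  have all: "S \<inter> E = {} \<or> E \<subseteq> S" if "E \<in> K" for E
    using sep_on_partial[OF assms(1) SU(2) that] other[of E] by blast
  have "B \<subseteq> S" "B' \<subseteq> S" using all B B' by blast+
  then show False
    using beta[OF B(1) B'(1,3)] sep_on_union_aux[OF assms(1) SA SU(1) all] B B' by blast
qed

lemma in_C_sep_on:
  assumes "S \<in> C" "S \<subseteq> A"
  shows "sep_on util A S"
proof -
  consider "S = {}" | "S = A" | "S \<noteq> {}" "S \<subset> A" using assms by blast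
  then show ?thesis
  proof cases
    case 3
    then obtain B where B: "B \<in> K" "S \<subseteq> B" using cover assms by blast
    then show ?thesis using sep_on_child rep assms unfolding represents_def by blast
  qed (auto simp: sep_on_def)
qed

lemma represents_util: "represents C A util"
  unfolding represents_def using sep_on_in_C in_C_sep_on by blast

lemma util_empty: "util {} = 0"
proof -
  have "bonus {} = 0"
  proof (cases corrected)
    case True
    then obtain B B' where "B \<in> K" "B' \<in> K" "B \<noteq> B'" unfolding corrected_def by blast
    then show ?thesis using Kne by (intro bonus_zero[where B = B]) (auto simp: missed_def)
  next
    case False
    then show ?thesis using ne by (simp add: bonus_def)
  qed
  then show ?thesis using u_empty by (simp add: util_def)
qed

lemma util_nonneg: "0 \<le> util x"
  unfolding util_def using bonus_nonneg u_nonneg by (simp add: sum_nonneg)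

lemma util_less: "x \<subset> A \<Longrightarrow> util x < util A"
proof -
  assume x: "x \<subset> A"
  have "(\<Sum>B\<in>K. u B (x \<inter> B)) \<le> (\<Sum>B\<in>K. u B (A \<inter> B))"
  proof (rule sum_mono)
    fix B assume "B \<in> K"
    moreover from this have "A \<inter> B = B" using Ksub by blast
    ultimately show "u B (x \<inter> B) \<le> u B (A \<inter> B)" using u_le_full by simp
  qed
  moreover have "bonus x < bonus A" using bonus_less x by blast
  ultimately show ?thesis unfolding util_def by linarith
qed

lemma util_pos:
  assumes "D \<in> C" "D \<subseteq> A" "D \<noteq> {}"
  shows "0 < util D"
proof (cases "D = A")
  case True
  then show ?thesis using util_less[of "{}"] util_empty ne by auto
next
  case False
  then obtain B where B: "B \<in> K" "D \<subseteq> B" using cover assms by blast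
  then have "0 < u B (D \<inter> B)" using u_pos assms by (simp add: Int_absorb2)
  moreover have "0 \<le> (\<Sum>B'\<in>K - {B}. u B' (D \<inter> B'))" using u_nonneg by (intro sum_nonneg) blast
  ultimately show ?thesis using util_split[OF B(1), of D] bonus_nonneg[of D] by simp
qed

end

section \<open>Rescaling and choice of bonuses\<close>

lemma sep_on_mono_transform:
  assumes "\<And>x y. x \<subseteq> A \<Longrightarrow> y \<subseteq> A \<Longrightarrow> u x \<le> u y \<longleftrightarrow> w x \<le> w y" "S \<subseteq> A" "sep_on u A S"
  shows "sep_on w A S"
  unfolding sep_on_def
proof (intro allI impI)
  fix x y v assume h: "x \<subseteq> S" "y \<subseteq> S" "v \<subseteq> A - S"
  then have "x \<subseteq> A" "y \<subseteq> A" "x \<union> v \<subseteq> A" "y \<union> v \<subseteq> A" using assms(2) by blast+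
  then show "w x \<le> w y \<longleftrightarrow> w (x \<union> v) \<le> w (y \<union> v)"
    using sep_on_iff[OF assms(3) h] assms(1) by simp
qed

lemma sep_on_cong:
  assumes "\<And>x y. x \<subseteq> A \<Longrightarrow> y \<subseteq> A \<Longrightarrow> u x \<le> u y \<longleftrightarrow> w x \<le> w y" "S \<subseteq> A"
  shows "sep_on u A S \<longleftrightarrow> sep_on w A S"
  using sep_on_mono_transform[OF assms] sep_on_mono_transform[OF assms(1)[symmetric] assms(2)]
  by (rule iffI)

text \<open>Separability depends only on the order. As \<open>A\<close> is the strict maximum, its
  value may be moved freely above the others, and proper subsets are divided by their maximum
  \<open>m\<close>. If \<open>m = 0\<close>, positivity leaves no nonempty proper subset of
  \<open>A\<close> in \<open>C\<close>, so the top value 1 is allowed.\<close>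

lemma exists_normalized:
  assumes fin: "finite A" and ne: "A \<noteq> {}" and u0: "u {} = 0"
    and nonneg: "\<And>x. x \<subseteq> A \<Longrightarrow> 0 \<le> u x" and top: "\<And>x. x \<subset> A \<Longrightarrow> u x < u A"
    and pos: "\<And>D. D \<in> C \<Longrightarrow> D \<subseteq> A \<Longrightarrow> D \<noteq> {} \<Longrightarrow> 0 < u D"
    and rep: "represents C A u"
  shows "\<exists>w. normalized C A w \<and> represents C A w"
proof -
  define m where "m = Max (u ` {x. x \<subset> A})"
  have f: "finite {x. x \<subset> A}" using fin by (auto intro: finite_subset[of _ "Pow A"])
  have e: "{} \<in> {x. x \<subset> A}" using ne by blast
  have le: "u x \<le> m" if "x \<subset> A" for x using f that unfolding m_def by (intro Max_ge) auto
  have "m \<in> u ` {x. x \<subset> A}" unfolding m_def using f e by (intro Max_in) auto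
  \<comment> \<open>After division by a nonzero \<open>m\<close> this maximizer has value exactly
    1.\<close>
  then obtain q where q: "q \<subset> A" "u q = m" by auto
  define w where "w x = (if x = A then (if m = 0 then 1 else 3) else if m = 0 then 0 else u x / m)" for x
  have m0: "0 \<le> m" using le[of "{}"] e u0 by simp
  have wle: "w x \<le> 1" "0 \<le> w x" "w x < w A" if "x \<subset> A" for x
  proof -
    have "x \<subseteq> A" "x \<noteq> A" using that by blast+
    then have *: "u x / m \<le> 1" "0 \<le> u x / m"
      using le[OF that] nonneg[of x] m0 by (auto simp: divide_le_eq_1)
    then show "w x \<le> 1" "0 \<le> w x" using \<open>x \<noteq> A\<close> by (auto simp: w_def)
    show "w x < w A" using * \<open>x \<noteq> A\<close> by (auto simp: w_def)
  qed
  have mono: "u x \<le> u y \<longleftrightarrow> w x \<le> w y" if xy: "x \<subseteq> A" "y \<subseteq> A" for x y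
  proof -
    consider "x = A" "y = A" | "x = A" "y \<subset> A" | "x \<subset> A" "y = A" | "x \<subset> A" "y \<subset> A"
      using xy by blast
    then show ?thesis
    proof cases
      case 4
      then have "x \<noteq> A" "y \<noteq> A" by blast+
      moreover have "u x = 0" "u y = 0" if "m = 0"
        using le[OF 4(1)] le[OF 4(2)] nonneg[OF xy(1)] nonneg[OF xy(2)] that by simp_all
      ultimately show ?thesis using m0 by (simp add: w_def divide_le_cancel)
    next
      case 2
      then show ?thesis using top[of y] wle[of y] by simp
    next
      case 3
      then show ?thesis using top[of x] wle[of x] by simp
    qed simp
  qed
  have "represents C A w"
    using rep sep_on_cong[of A u w, OF mono] unfolding represents_def by blast
  moreover have "normalized C A w" unfolding normalized_def
  proof (intro conjI allI impI ballI)
    show w0: "w {} = 0" using ne u0 by (simp add: w_def)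
    show "0 \<le> w x" if "x \<subseteq> A" for x using wle[of x] that by (cases "x = A") (auto simp: w_def)
    show "w x \<le> 1" "w x < w A" if "x \<subset> A" for x using wle that by blast+
    show "w A = 1 \<or> w A = 3" by (simp add: w_def)
    show "\<exists>q\<subseteq>A. w q = 1"
    proof (cases "m = 0")
      case True
      then show ?thesis by (auto simp: w_def)
    next
      case False
      then show ?thesis using q by (auto simp: w_def intro!: exI[of _ q])
    qed
    fix D assume D: "D \<in> C" "D \<subseteq> A" "D \<noteq> {}"
    show "0 < w D" using pos[OF D] mono[of D "{}"] D u0 w0 by simp
    show "w A = 3" if "D \<noteq> A"
    proof -
      have "u D \<le> m" using le D(2) that by blast
      then show ?thesis using pos[OF D] by (simp add: w_def)
    qed
  qed
  ultimately show ?thesis by blast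
qed

lemma exists_spread:
  assumes "finite K" and F: "\<And>B. B \<in> K \<Longrightarrow> F B = 1 \<or> F B = (3::real)"
  shows "\<exists>\<beta> :: 'a \<Rightarrow> real. (\<forall>B\<in>K. 0 \<le> \<beta> B) \<and> (\<forall>B\<in>K. \<forall>B'\<in>K. B \<noteq> B' \<longrightarrow>
    \<beta> B + 3 \<le> \<beta> B' \<and> F B \<le> F B' \<or> \<beta> B' + 3 \<le> \<beta> B \<and> F B' \<le> F B)"
proof -
  obtain f :: "'a \<Rightarrow> nat" and N where f: "f ` K = {i. i < N}" "inj_on f K"
    using finite_imp_inj_to_nat_seg[OF assms(1)] by blast
  \<comment> \<open>Lexicographic: a jump of \<open>F\<close> by 2 adds \<open>6 * N\<close> and
    outweighs the index term, which stays below \<open>3 * N\<close>; ties in \<open>F\<close> are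
    broken by distinct indices, 3 apart.\<close>
  define \<beta> where "\<beta> B = 3 * real (f B) + 3 * real N * F B" for B
  have lt: "real (f B) + 1 \<le> real N" if "B \<in> K" for B
  proof -
    have "f B < N" using f that by blast
    then show ?thesis by linarith
  qed
  have "0 \<le> \<beta> B" if "B \<in> K" for B using F[OF that] by (auto simp: \<beta>_def)
  moreover have "\<beta> B + 3 \<le> \<beta> B' \<and> F B \<le> F B' \<or> \<beta> B' + 3 \<le> \<beta> B \<and> F B' \<le> F B"
    if "B \<in> K" "B' \<in> K" "B \<noteq> B'" for B B'
  proof -
    have "f B < f B' \<or> f B' < f B" using f that by (meson inj_on_eq_iff linorder_neqE_nat)
    then have "real (f B) + 1 \<le> real (f B') \<or> real (f B') + 1 \<le> real (f B)" by linarith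
    moreover have "F B = 1 \<or> F B = 3" "F B' = 1 \<or> F B' = 3" using F that by blast+
    ultimately show ?thesis using lt[OF that(1)] lt[OF that(2)] unfolding \<beta>_def by auto
  qed
  ultimately show ?thesis by blast
qed

section \<open>Induction over the tree\<close>

text \<open>\<open>C\<close> stays fixed while \<open>A\<close> runs through its nonempty members,
  so the induction hypothesis applies directly to each child.\<close>

lemma laminar_representable:
  assumes "finite A" "A \<noteq> {}" "A \<in> C" "{} \<in> C"
    and lam: "\<And>D E. D \<in> C \<Longrightarrow> E \<in> C \<Longrightarrow> D \<subseteq> E \<or> E \<subseteq> D \<or> D \<inter> E = {}"
  shows "\<exists>u. normalized C A u \<and> represents C A u"
  using assms(1-3)
proof (induction A rule: finite_psubset_induct)
  case (psubset A)
  define P where "P = {D \<in> C. D \<subset> A \<and> D \<noteq> {}}"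
  \<comment> \<open>The children are the maximal nonempty members of \<open>C\<close> properly
    inside \<open>A\<close>: laminarity makes them disjoint, and finiteness puts every smaller
    nonempty member below one of them.\<close>
  define K where "K = {B \<in> P. \<forall>D\<in>P. B \<subseteq> D \<longrightarrow> D = B}"
  have finP: "finite P" unfolding P_def using psubset.hyps(1)
    by (auto intro: finite_subset[of _ "Pow A"])
  have "\<exists>w. normalized C B w \<and> represents C B w" if "B \<in> K" for B
    using psubset.IH[of B] that unfolding K_def P_def by blast
  then obtain u where u: "\<And>B. B \<in> K \<Longrightarrow> normalized C B (u B) \<and> represents C B (u B)" by metis
  have "u B B = 1 \<or> u B B = 3" if "B \<in> K" for B using u[OF that] unfolding normalized_def by blast
  moreover have "finite K" using finP unfolding K_def by simp
  ultimately obtain \<beta> :: "'a set \<Rightarrow> real" where \<beta>: "\<And>B. B \<in> K \<Longrightarrow> 0 \<le> \<beta> B"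
    "\<And>B B'. B \<in> K \<Longrightarrow> B' \<in> K \<Longrightarrow> B \<noteq> B' \<Longrightarrow>
    \<beta> B + 3 \<le> \<beta> B' \<and> u B B \<le> u B' B' \<or> \<beta> B' + 3 \<le> \<beta> B \<and> u B' B' \<le> u B B"
    using exists_spread[of K "\<lambda>B. u B B"] by metis
  interpret node A C K u \<beta>
  proof unfold_locales
    show "finite A" "A \<noteq> {}" "A \<in> C" "{} \<in> C" using psubset assms(4) by blast+
    show "B \<inter> B' = {}" if "B \<in> K" "B' \<in> K" "B \<noteq> B'" for B B'
    proof -
      have "B \<in> P" "B' \<in> P" "\<not> B \<subseteq> B'" "\<not> B' \<subseteq> B" using that unfolding K_def by blast+
      then show ?thesis using lam[of B B'] unfolding P_def by blast
    qed
    show "B \<noteq> {}" "B \<subset> A" if "B \<in> K" for B using that unfolding K_def P_def by blast+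
    show "\<exists>B\<in>K. D \<subseteq> B" if "D \<in> C" "D \<subset> A" "D \<noteq> {}" for D
    proof -
      have "D \<in> P" using that unfolding P_def by blast
      then obtain B where "B \<in> P" "D \<subseteq> B" "\<forall>E\<in>P. B \<subseteq> E \<longrightarrow> B = E"
        using finite_has_maximal2[OF finP] by metis
      then show ?thesis unfolding K_def by blast
    qed
  qed (simp_all add: u \<beta>)
  show ?case
    by (rule exists_normalized[OF fin ne util_empty util_nonneg util_less util_pos represents_util])
qed

theorem theorem1p3:
  fixes n :: nat and C :: "nat set set"
  assumes "n \<ge> 1" and "tree_character n C"
  shows "admissible n C"
proof -
  let ?A = "{1..n}"
  have C: "C \<subseteq> Pow ?A" "{} \<in> C" "?A \<in> C"
    and lam: "\<And>D E. D \<in> C \<Longrightarrow> E \<in> C \<Longrightarrow> D \<subseteq> E \<or> E \<subseteq> D \<or> D \<inter> E = {}"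
    using assms(2) unfolding tree_character_def by blast+
  have "?A \<noteq> {}" using assms(1) by simp
  then obtain u where u: "represents C ?A u"
    using laminar_representable[OF _ _ C(3,2) lam] by blast
  \<comment> \<open>The pair order is opposite to that of \<open>sep_on\<close>; this is harmless,
    since both notions of separability quantify over all \<open>x\<close> and
    \<open>y\<close>.\<close>
  define R where "R = {(x, y). x \<subseteq> ?A \<and> y \<subseteq> ?A \<and> u y \<le> u x}"
  have "preference_order n R"
    unfolding preference_order_def preorder_on_def refl_on_def trans_def total_on_def R_def by auto
  moreover have "separable n R S \<longleftrightarrow> sep_on u ?A S" if "S \<subseteq> ?A" for S
  proof -
    have "(x \<union> v, y \<union> v) \<in> R \<longleftrightarrow> u (y \<union> v) \<le> u (x \<union> v)"
      if "x \<subseteq> S" "y \<subseteq> S" "v \<subseteq> ?A - S" for x y v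
      using that \<open>S \<subseteq> ?A\<close> unfolding R_def by blast
    moreover from this[where v = "{}"]
    have "(x, y) \<in> R \<longleftrightarrow> u y \<le> u x" if "x \<subseteq> S" "y \<subseteq> S" for x y
      using that by simp
    ultimately show ?thesis
      unfolding separable_def sep_on_def partial_outcomes_def combine_def zero_outcome_def
      by (simp add: Ball_def Pow_def) meson
  qed
  then have "character n R = C"
    using u C(1) unfolding character_def represents_def by blast
  ultimately show ?thesis unfolding admissible_def by blast
qed

end
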